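(* Let $D$ be a set, $k$ a positive integer, and $X\subseteq D^k$ a finite symmetric subset. Let $j$ be a positive integer and let $\mathcal{M}_j(X)$ be the set of $k$-multisets in $\mathcal{M}(X)$ in which every element has multiplicity at most $j$. Then $$|\mathcal{M}_j(X)|=\frac{1}{k!}\sum_{\tau\in S_k} w_j(\tau)\,|X_\tau|.$$ In particular, for $j\ge k$, $$|\mathcal{M}(X)|=\frac{1}{k!}\sum_{\tau\in S_k}|X_\tau|.$$
   Context: $D^k$ is the Cartesian product of $k$ copies of $D$. A subset $X\subseteq D^k$ is symmetric if $(x_{\tau(1)},\dots,x_{\tau(k)})\in X$ whenever $(x_1,\dots,x_k)\in X$ and $\tau\in S_k$. $\mathcal{M}(X)=\{[x_1,\dots,x_k]:(x_1,\dots,x_k)\in X\}$ is the set of $k$-multisets whose underlying ordered tuples lie in $X$ (square brackets denote multisets). For $\tau\in S_k$, $X_\tau$ is the set of $(x_1,\dots,x_k)\in X$ invariant under $\tau$, i.e. such that $x_i$ is constant on each cycle of $\tau$. If $\tau$ has disjoint cycle decomposition $\tau=\tau_1\cdots\tau_{c(\tau)}$ (fixed points counted as cycles of length 1) with cycle lengths $\ell_1,\dots,\ell_{c(\tau)}$, then $w_j(\tau)=\prod_{i=1}^{c(\tau)}\bigl(1-(j+1)\,1_{(j+1)\mid \ell_i}\bigr)$, where $1_S$ is $1$ if $S$ is true and $0$ otherwise. *)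

theory Defs
  imports Complex_Main "HOL-Library.Multiset" "HOL-Library.NList"
    "HOL-Combinatorics.Permutations" "HOL-Combinatorics.Orbits"
begin

text \<open>A tuple in \<open>D\<^sup>k\<close> is a list in \<^term>\<open>nlists k D\<close>, so positions run through
  \<open>0, \<dots>, k - 1\<close> and \<open>S\<^sub>k\<close> is the set of all \<open>\<tau>\<close> with \<^prop>\<open>\<tau> permutes {..<k}\<close>.
  The tuple \<open>(x\<^bsub>\<tau>(1)\<^esub>, \<dots>, x\<^bsub>\<tau>(k)\<^esub>)\<close> is \<^term>\<open>permute_list \<tau> xs\<close>.\<close>

definition symmetric_tuples :: "nat \<Rightarrow> 'a list set \<Rightarrow> bool" where
  "symmetric_tuples k X \<longleftrightarrow>
     (\<forall>xs\<in>X. \<forall>\<tau>. \<tau> permutes {..<k} \<longrightarrow> permute_list \<tau> xs \<in> X)"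

definition multisets_of :: "'a list set \<Rightarrow> 'a multiset set" where
  "multisets_of X = mset ` X"

definition bounded_multisets_of :: "nat \<Rightarrow> 'a list set \<Rightarrow> 'a multiset set" where
  "bounded_multisets_of j X = {M \<in> multisets_of X. \<forall>x\<in>#M. count M x \<le> j}"

definition invariant_tuples :: "'a list set \<Rightarrow> (nat \<Rightarrow> nat) \<Rightarrow> 'a list set" where
  "invariant_tuples X \<tau> = {xs \<in> X. permute_list \<tau> xs = xs}"

text \<open>Each cycle in the disjoint cycle decomposition is identified with the set of positions
  it moves cyclically. A fixed point \<open>i\<close> contributes the cycle \<open>{i}\<close>.\<close>

definition perm_cycles :: "nat \<Rightarrow> (nat \<Rightarrow> nat) \<Rightarrow> nat set set" where
  "perm_cycles k \<tau> = orbit \<tau> ` {..<k}"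

definition cycle_weight :: "nat \<Rightarrow> nat \<Rightarrow> (nat \<Rightarrow> nat) \<Rightarrow> int" where
  "cycle_weight k j \<tau> =
     (\<Prod>C\<in>perm_cycles k \<tau>. 1 - (int j + 1) * of_bool ((j + 1) dvd card C))"

lemma invariant_tuples_iff_constant_on_cycles:
  assumes "X \<subseteq> nlists k D" and perm: "\<tau> permutes {..<k}"
  shows "invariant_tuples X \<tau> =
    {xs \<in> X. \<forall>C\<in>perm_cycles k \<tau>. \<forall>i\<in>C. \<forall>i'\<in>C. xs ! i = xs ! i'}"
proof -
  have "permute_list \<tau> xs = xs \<longleftrightarrow>
      (\<forall>C\<in>perm_cycles k \<tau>. \<forall>i\<in>C. \<forall>i'\<in>C. xs ! i = xs ! i')" if "xs \<in> X" for xs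
  proof -
    have len: "length xs = k"
      using that assms(1) nlistsE_length by blast
    have step: "permute_list \<tau> xs = xs \<longleftrightarrow> (\<forall>i<k. xs ! \<tau> i = xs ! i)"
      by (auto simp: list_eq_iff_nth_eq len permute_list_def)
    have self: "i \<in> orbit \<tau> i" for i
      by (rule permutation_self_in_orbit) (use perm in \<open>auto simp: permutation_permutes\<close>)
    have const: "xs ! a = xs ! i" if inv: "\<forall>i<k. xs ! \<tau> i = xs ! i" and "i < k"
      and "a \<in> orbit \<tau> i" for a i
    proof -
      from \<open>a \<in> orbit \<tau> i\<close> have "a < k \<and> xs ! a = xs ! i"
      proof induction
        case base
        then show ?case
          using inv \<open>i < k\<close> permutes_in_image[OF perm, of i] by auto
      next
        case (step y)
        then show ?case
          using inv permutes_in_image[OF perm, of y] by auto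
      qed
      then show ?thesis ..
    qed
    show ?thesis
      unfolding step perm_cycles_def
    proof (intro iffI ballI allI impI)
      fix C i i'
      assume inv: "\<forall>i<k. xs ! \<tau> i = xs ! i"
        and "C \<in> orbit \<tau> ` {..<k}" and i: "i \<in> C" "i' \<in> C"
      then obtain m where m: "m < k" "C = orbit \<tau> m"
        by blast
      show "xs ! i = xs ! i'"
        using const[OF inv m(1)] i m(2) by simp
    next
      fix i
      assume *: "\<forall>C\<in>orbit \<tau> ` {..<k}. \<forall>i\<in>C. \<forall>i'\<in>C. xs ! i = xs ! i'" and "i < k"
      then have "orbit \<tau> i \<in> orbit \<tau> ` {..<k}"
        by simp
      then show "xs ! \<tau> i = xs ! i"
        using * self[of i] orbit.base[of \<tau> i] by blast
    qed
  qed
  then show ?thesis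
    by (auto simp: invariant_tuples_def)
qed

end

theory Submission
  imports Defs "HOL-Combinatorics.Multiset_Permutations"
begin

text \<open>Exchanging the sums, a tuple \<open>xs\<close> contributes the total weight of the permutations fixing
  it, that is, preserving its level sets. Splitting such a permutation at the cycle \<open>C\<close> through a
  position \<open>s\<close> with level set of size \<open>m\<close> replaces \<open>m\<close> by \<open>m - card C\<close>. Since \<open>j + 1\<close> consecutive
  cycle weights \<open>1 - (j + 1) [j + 1 dvd l]\<close> sum to zero, this recurrence is solved by the product
  over the level sets of \<open>m!\<close> if \<open>m \<le> j\<close> and \<open>0\<close> otherwise. Hence a tuple with multiset \<open>M\<close>
  contributes \<open>\<Prod>x. (count M x)!\<close> or \<open>0\<close>, and all the orderings of \<open>M\<close> together \<open>k!\<close> or \<open>0\<close>.\<close>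

section \<open>Permutations preserving a function, and their cycle weights\<close>

definition stabilizing_perms :: "'a set \<Rightarrow> ('a \<Rightarrow> 'b) \<Rightarrow> ('a \<Rightarrow> 'a) set" where
  "stabilizing_perms S f = {\<tau>. \<tau> permutes S \<and> (\<forall>i\<in>S. f (\<tau> i) = f i)}"

text \<open>The set \<open>S\<close> is arbitrary because deleting a cycle from
  \<open>{..<k}\<close> need not leave an initial segment. The semiring is generic so that
  \<open>c = 1\<close> over the naturals counts permutations, while the signed cycle weights live in
  the integers.\<close>

definition orbit_weight :: "(nat \<Rightarrow> 'c::comm_semiring_1) \<Rightarrow> 'a set \<Rightarrow> ('a \<Rightarrow> 'a) \<Rightarrow> 'c" where
  "orbit_weight c S \<tau> = (\<Prod>C\<in>orbit \<tau> ` S. c (card C))"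

lemma finite_stabilizing_perms: "finite S \<Longrightarrow> finite (stabilizing_perms S f)"
  by (rule finite_subset[OF _ finite_permutations[of S]]) (auto simp: stabilizing_perms_def)

lemma stabilizing_orbit_subset:
  assumes "\<tau> \<in> stabilizing_perms S f" and "s \<in> S"
  shows "orbit \<tau> s \<subseteq> {i \<in> S. f i = f s}"
proof
  fix y assume "y \<in> orbit \<tau> s"
  then show "y \<in> {i \<in> S. f i = f s}"
    using assms by induction (auto simp: stabilizing_perms_def permutes_in_image)
qed

section \<open>Splitting off a single cycle\<close>

text \<open>The supports are disjoint, so each factor acts alone on its own block and keeps its
  orbits there.\<close>

lemma cyclic_permutes_comp:
  assumes "finite S" "C \<subseteq> S" and \<sigma>: "\<sigma> permutes C" "cyclic_on \<sigma> C" and \<rho>: "\<rho> permutes S - C"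
  shows "\<sigma> \<circ> \<rho> permutes S"
    and "i \<in> C \<Longrightarrow> (\<sigma> \<circ> \<rho>) i = \<sigma> i"
    and "i \<notin> C \<Longrightarrow> (\<sigma> \<circ> \<rho>) i = \<rho> i"
    and "i \<in> C \<Longrightarrow> orbit (\<sigma> \<circ> \<rho>) i = C"
    and "i \<in> S - C \<Longrightarrow> orbit (\<sigma> \<circ> \<rho>) i = orbit \<rho> i"
proof -
  show "\<sigma> \<circ> \<rho> permutes S"
    using permutes_subset[OF \<sigma>(1) assms(2)] permutes_subset[OF \<rho>] by (auto intro: permutes_compose)
  show on_C: "(\<sigma> \<circ> \<rho>) i = \<sigma> i" if "i \<in> C" for i
    using that permutes_not_in[OF \<rho>, of i] by simp
  \<comment> \<open>A point outside \<open>C\<close> is sent by \<rho> to a point outside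
    \<open>C\<close>, where \<sigma> is the identity.\<close>
  show off_C: "(\<sigma> \<circ> \<rho>) i = \<rho> i" if "i \<notin> C" for i
    using that permutes_not_in[OF \<sigma>(1), of "\<rho> i"] permutes_in_image[OF \<rho>, of i]
      permutes_not_in[OF \<rho>, of i] by (cases "i \<in> S") auto
  show "orbit (\<sigma> \<circ> \<rho>) i = C" if "i \<in> C"
    using that \<sigma>(2) on_C by (metis cyclic_cong orbit_cyclic_eq3)
  show "orbit (\<sigma> \<circ> \<rho>) i = orbit \<rho> i" if "i \<in> S - C"
  proof (rule orbit_cong)
    show "i \<in> orbit \<rho> i"
      by (rule permutation_self_in_orbit) (use \<rho> \<open>finite S\<close> in \<open>auto simp: permutation_permutes\<close>)
    show "(\<sigma> \<circ> \<rho>) x = \<rho> x" if "x \<in> orbit \<rho> i" for x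
      using that permutes_orbit_subset[OF \<rho> \<open>i \<in> S - C\<close>] off_C by auto
  qed
qed

text \<open>All points of \<open>C\<close> share the orbit \<open>C\<close>, and the other orbits
  stay inside \<open>S - C\<close>. Since the product runs over a set of orbits, \<open>C\<close>
  has to be new to that set before its factor can be split off.\<close>

lemma orbit_weight_split_cycle:
  assumes "finite S" "C \<subseteq> S" "C \<noteq> {}" and \<sigma>: "\<sigma> permutes C" "cyclic_on \<sigma> C"
    and \<rho>: "\<rho> permutes S - C"
  shows "orbit_weight c S (\<sigma> \<circ> \<rho>) = c (card C) * orbit_weight c (S - C) \<rho>"
proof -
  note comp = cyclic_permutes_comp[OF assms(1,2) \<sigma> \<rho>]
  have "orbit (\<sigma> \<circ> \<rho>) ` S = orbit (\<sigma> \<circ> \<rho>) ` C \<union> orbit (\<sigma> \<circ> \<rho>) ` (S - C)"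
    using \<open>C \<subseteq> S\<close> by blast
  also have "\<dots> = insert C (orbit \<rho> ` (S - C))"
    using comp(4,5) \<open>C \<noteq> {}\<close> by (simp add: image_constant_conv cong: image_cong_simp)
  finally have "orbit (\<sigma> \<circ> \<rho>) ` S = insert C (orbit \<rho> ` (S - C))" .
  moreover have "C \<notin> orbit \<rho> ` (S - C)"
    using permutes_orbit_subset[OF \<rho>] \<open>C \<noteq> {}\<close> by blast
  ultimately show ?thesis
    using \<open>finite S\<close> by (simp add: orbit_weight_def)
qed

text \<open>Classify \<tau> by its orbit \<open>C\<close> through \<open>s\<close>, which lies in
  the level set of \<open>s\<close>. For fixed \<open>C\<close>, \<tau> factors uniquely into a full
  cycle on \<open>C\<close> and a level-preserving permutation of \<open>S - C\<close>. Every full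
  cycle on \<open>C\<close> is admissible because \<open>f\<close> is constant there, so these
  cycles enter only through their number.\<close>

lemma sum_stabilizing_perms_by_cycle:
  fixes c :: "nat \<Rightarrow> 'c::comm_semiring_1"
  assumes "finite S" "s \<in> S"
  shows "(\<Sum>\<tau>\<in>stabilizing_perms S f. orbit_weight c S \<tau>) =
    (\<Sum>C | s \<in> C \<and> C \<subseteq> {i \<in> S. f i = f s}.
       of_nat (card {\<sigma>. \<sigma> permutes C \<and> cyclic_on \<sigma> C}) * c (card C) *
       (\<Sum>\<rho>\<in>stabilizing_perms (S - C) f. orbit_weight c (S - C) \<rho>))"
    (is "_ = (\<Sum>C\<in>?\<C>. ?F C)")
proof -
  have "(\<Sum>\<tau>\<in>stabilizing_perms S f. orbit_weight c S \<tau>) =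
    (\<Sum>C\<in>?\<C>. \<Sum>\<tau> | \<tau> \<in> stabilizing_perms S f \<and> orbit \<tau> s = C. orbit_weight c S \<tau>)"
  proof (rule sum.group[symmetric])
    show "finite (stabilizing_perms S f)"
      by (rule finite_stabilizing_perms) fact
    show "finite ?\<C>"
      by (rule finite_subset[of _ "Pow S"]) (use \<open>finite S\<close> in auto)
    show "(\<lambda>\<tau>. orbit \<tau> s) ` stabilizing_perms S f \<subseteq> ?\<C>"
    proof
      fix C assume "C \<in> (\<lambda>\<tau>. orbit \<tau> s) ` stabilizing_perms S f"
      then obtain \<tau> where \<tau>: "\<tau> \<in> stabilizing_perms S f" "C = orbit \<tau> s" by auto
      have "s \<in> orbit \<tau> s"
        by (rule permutation_self_in_orbit)
          (use \<tau> \<open>finite S\<close> in \<open>auto simp: permutation_permutes stabilizing_perms_def\<close>)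
      then show "C \<in> ?\<C>"
        using stabilizing_orbit_subset[OF \<tau>(1) \<open>s \<in> S\<close>] \<tau>(2) by auto
    qed
  qed
  also have "\<dots> = (\<Sum>C\<in>?\<C>. ?F C)"
  proof (rule sum.cong[OF refl])
    fix C assume "C \<in> ?\<C>"
    then have C: "s \<in> C" "C \<subseteq> S" "C \<noteq> {}" and level: "\<And>i. i \<in> C \<Longrightarrow> f i = f s"
      by auto
    let ?Z = "{\<sigma>. \<sigma> permutes C \<and> cyclic_on \<sigma> C}" and ?R = "stabilizing_perms (S - C) f"
    have "(\<Sum>\<tau> | \<tau> \<in> stabilizing_perms S f \<and> orbit \<tau> s = C. orbit_weight c S \<tau>) =
      (\<Sum>(\<sigma>, \<rho>)\<in>?Z \<times> ?R. c (card C) * orbit_weight c (S - C) \<rho>)"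
    proof (rule sum.reindex_bij_witness[symmetric])
      \<comment> \<open>Restricting to \<open>C\<close> and to \<open>S - C\<close> is inverse to
        composing the two pieces.\<close>
      let ?split = "\<lambda>\<tau>. (perm_restrict \<tau> C, perm_restrict \<tau> (S - C))"
      let ?join = "\<lambda>(\<sigma>, \<rho>). \<sigma> \<circ> \<rho> :: _ \<Rightarrow> _"
      {
        fix p assume p: "p \<in> ?Z \<times> ?R"
        obtain \<sigma> \<rho> where [simp]: "p = (\<sigma>, \<rho>)" by (cases p)
        have \<sigma>: "\<sigma> permutes C" "cyclic_on \<sigma> C" and \<rho>: "\<rho> permutes S - C"
          and \<rho>f: "\<And>i. i \<in> S - C \<Longrightarrow> f (\<rho> i) = f i"
          using p by (auto simp: stabilizing_perms_def)
        note comp = cyclic_permutes_comp[OF \<open>finite S\<close> C(2) \<sigma> \<rho>]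
        show "?split (?join p) = p"
          using comp(2,3) permutes_not_in[OF \<sigma>(1)] permutes_not_in[OF \<rho>]
          by (auto simp: perm_restrict_def fun_eq_iff)
        have "f ((\<sigma> \<circ> \<rho>) i) = f i" if "i \<in> S" for i
        proof (cases "i \<in> C")
          case True
          then show ?thesis
            using comp(2) level permutes_in_image[OF \<sigma>(1)] by metis
        next
          case False
          then show ?thesis
            using comp(3) \<rho>f that by auto
        qed
        then show "?join p \<in> {\<tau>. \<tau> \<in> stabilizing_perms S f \<and> orbit \<tau> s = C}"
          using comp(1) comp(4)[OF C(1)] by (simp add: stabilizing_perms_def)
        show "orbit_weight c S (?join p) =
            (case p of (\<sigma>, \<rho>) \<Rightarrow> c (card C) * orbit_weight c (S - C) \<rho>)"
          using orbit_weight_split_cycle[OF \<open>finite S\<close> C(2,3) \<sigma> \<rho>] by simp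
      }
      {
        fix \<tau> assume "\<tau> \<in> {\<tau>. \<tau> \<in> stabilizing_perms S f \<and> orbit \<tau> s = C}"
        then have \<tau>: "\<tau> permutes S" "\<And>i. i \<in> S \<Longrightarrow> f (\<tau> i) = f i" and orb: "orbit \<tau> s = C"
          by (auto simp: stabilizing_perms_def)
        have cyc: "cyclic_on \<tau> C"
          using cyclic_on_orbit[OF \<tau>(1) \<open>finite S\<close>, of s] orb by simp
        have rest: "perm_restrict \<tau> (S - C) permutes S - C"
          by (rule perm_restrict_diff_cyclic[OF \<tau>(1) cyc])
        have on_C: "perm_restrict \<tau> C permutes C"
        proof (rule bij_imp_permutes)
          \<comment> \<open>An injective self-map of the finite set \<open>C\<close> is
            onto.\<close>
          have "\<tau> ` C = C"
            using cyc \<tau>(1) C(2) \<open>finite S\<close> cyclic_on_inI[OF cyc] permutes_inj_on[OF \<tau>(1)]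
            by (intro endo_inj_surj) (auto intro: finite_subset)
          then show "bij_betw (perm_restrict \<tau> C) C C"
            using permutes_inj_on[OF \<tau>(1), of C]
            by (simp add: bij_betw_def perm_restrict_def cong: inj_on_cong image_cong_simp)
        qed (simp add: perm_restrict_simps)
        show "?join (?split \<tau>) = \<tau>"
          using perm_restrict_union[OF on_C rest] \<tau>(1) C(2) by (simp add: Un_absorb1)
        show "?split \<tau> \<in> ?Z \<times> ?R"
          using on_C rest cyc \<tau>(2)
          by (auto simp: cyclic_on_perm_restrict stabilizing_perms_def perm_restrict_simps)
      }
    qed
    also have "\<dots> = ?F C"
      by (simp add: sum.cartesian_product[symmetric] sum_distrib_left mult.assoc)
    finally show "(\<Sum>\<tau> | \<tau> \<in> stabilizing_perms S f \<and> orbit \<tau> s = C. orbit_weight c S \<tau>) = ?F C" .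
  qed
  finally show ?thesis .
qed

section \<open>Counting subsets and full cycles\<close>

text \<open>Removing \<open>s\<close> matches the sets of size \<open>l\<close> with the subsets of
  \<open>B - {s}\<close> of size \<open>l - 1\<close>.\<close>

lemma sum_card_subsets_containing:
  fixes h :: "nat \<Rightarrow> 'c::comm_semiring_1"
  assumes "finite B" "s \<in> B"
  shows "(\<Sum>C | s \<in> C \<and> C \<subseteq> B. h (card C)) =
    (\<Sum>l=1..card B. of_nat ((card B - 1) choose (l - 1)) * h l)"
proof -
  have fin: "finite {C. s \<in> C \<and> C \<subseteq> B}"
    by (rule finite_subset[of _ "Pow B"]) (use assms in auto)
  \<comment> \<open>The bound on \<open>l\<close> guards against truncated subtraction: for
    \<open>l = 0\<close> no set qualifies, yet the binomial coefficient would be 1.\<close>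
  have num: "card {C. (s \<in> C \<and> C \<subseteq> B) \<and> card C = l} = (card B - 1) choose (l - 1)" if "l \<ge> 1" for l
  proof -
    have "card {C. (s \<in> C \<and> C \<subseteq> B) \<and> card C = l} = card {A. A \<subseteq> B - {s} \<and> card A = l - 1}"
    proof (rule bij_betw_same_card, rule bij_betw_byWitness[where f = "\<lambda>C. C - {s}" and f' = "insert s"])
      show "\<forall>C\<in>{C. (s \<in> C \<and> C \<subseteq> B) \<and> card C = l}. insert s (C - {s}) = C"
        by auto
      show "\<forall>A\<in>{A. A \<subseteq> B - {s} \<and> card A = l - 1}. insert s A - {s} = A"
        by auto
      show "(\<lambda>C. C - {s}) ` {C. (s \<in> C \<and> C \<subseteq> B) \<and> card C = l} \<subseteq> {A. A \<subseteq> B - {s} \<and> card A = l - 1}"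
        by (auto simp: card_Diff_singleton)
      show "insert s ` {A. A \<subseteq> B - {s} \<and> card A = l - 1} \<subseteq> {C. (s \<in> C \<and> C \<subseteq> B) \<and> card C = l}"
      proof
        fix C assume "C \<in> insert s ` {A. A \<subseteq> B - {s} \<and> card A = l - 1}"
        then obtain A where A: "A \<subseteq> B - {s}" "card A = l - 1" "C = insert s A" by auto
        then have "finite A" "s \<notin> A" using \<open>finite B\<close> finite_subset by auto
        then show "C \<in> {C. (s \<in> C \<and> C \<subseteq> B) \<and> card C = l}"
          using A that \<open>s \<in> B\<close> by auto
      qed
    qed
    then show ?thesis
      using n_subsets[of "B - {s}" "l - 1"] assms by (simp add: card_Diff_singleton)
  qed
  have "(\<Sum>C | s \<in> C \<and> C \<subseteq> B. h (card C)) =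
    (\<Sum>l=1..card B. \<Sum>C | C \<in> {C. s \<in> C \<and> C \<subseteq> B} \<and> card C = l. h (card C))"
  proof (rule sum.group[symmetric, OF fin])
    show "card ` {C. s \<in> C \<and> C \<subseteq> B} \<subseteq> {1..card B}"
      using assms by (force simp: card_mono Suc_le_eq card_gt_0_iff dest: finite_subset)
  qed simp
  also have "\<dots> = (\<Sum>l=1..card B. of_nat ((card B - 1) choose (l - 1)) * h l)"
    by (rule sum.cong) (use num in auto)
  finally show ?thesis .
qed

text \<open>The left side counts the permutations of \<open>m\<close> points whose cycle through a
  given point has length \<open>l\<close>. Its independence of \<open>l\<close> is what reduces the
  later recurrences to plain sums of weights.\<close>

lemma binomial_fact_split:
  assumes "1 \<le> l" "l \<le> m"
  shows "((m - 1) choose (l - 1)) * fact (l - 1) * fact (m - l) = (fact (m - 1) :: nat)"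
  using binomial_fact_lemma[of "l - 1" "m - 1"] assms by (simp add: mult_ac)

text \<open>Counting all permutations of \<open>C\<close> by the cycle through one element determines the number of
  full cycles: the full cycles form the only term not known inductively.\<close>

lemma card_full_cycles:
  assumes "finite C" "C \<noteq> {}"
  shows "card {\<sigma>. \<sigma> permutes C \<and> cyclic_on \<sigma> C} = fact (card C - 1)"
  using assms
proof (induction "card C" arbitrary: C rule: less_induct)
  case less
  then obtain s where s: "s \<in> C" by blast
  let ?z = "\<lambda>A. card {\<sigma>. \<sigma> permutes A \<and> cyclic_on \<sigma> A}"
  let ?\<C> = "{A. s \<in> A \<and> A \<subseteq> C}" and ?m = "card C"
  let ?h = "\<lambda>l. fact (l - 1) * fact (?m - l) :: nat"
  have m: "?m \<ge> 1" using less.prems by (simp add: Suc_le_eq card_gt_0_iff)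
  have fin: "finite ?\<C>"
    by (rule finite_subset[of _ "Pow C"]) (use less.prems in auto)
  \<comment> \<open>A constant function is preserved by every permutation, so with unit weights the
    sum just counts permutations.\<close>
  have total: "(\<Sum>\<tau>\<in>stabilizing_perms A (\<lambda>_. ()). orbit_weight (\<lambda>_. 1) A \<tau>) = (fact (card A) :: nat)"
    if "finite A" for A :: "'a set"
    using card_permutations[OF refl that] by (simp add: stabilizing_perms_def orbit_weight_def)
  have "fact ?m = (\<Sum>A\<in>?\<C>. ?z A * fact (card (C - A)))"
    using sum_stabilizing_perms_by_cycle[OF less.prems(1) s,
        where f = "\<lambda>_. ()" and c = "\<lambda>_. 1 :: nat"] less.prems(1)
    by (simp add: total del: One_nat_def)
  also have "\<dots> = (\<Sum>A\<in>?\<C>. ?z A * fact (?m - card A))"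
    by (intro sum.cong refl) (metis (no_types, lifting) card_Diff_subset finite_subset less.prems(1) mem_Collect_eq)
  also have "\<dots> = ?z C + (\<Sum>A\<in>?\<C> - {C}. ?z A * fact (?m - card A))"
    using s by (subst sum.remove[OF fin, of C]) auto
  also have "(\<Sum>A\<in>?\<C> - {C}. ?z A * fact (?m - card A)) = (\<Sum>A\<in>?\<C> - {C}. ?h (card A))"
  proof (rule sum.cong[OF refl])
    fix A assume A: "A \<in> ?\<C> - {C}"
    then have "card A < card C" "finite A" "A \<noteq> {}"
      using less.prems(1) by (auto intro: psubset_card_mono finite_subset)
    then show "?z A * fact (?m - card A) = ?h (card A)"
      using less.hyps by simp
  qed
  \<comment> \<open>The added \<open>fact (?m - 1)\<close> is the value of \<open>?h\<close> at
    \<open>A = C\<close>; it completes the sum on the right to all of \<open>?\<C>\<close>.\<close>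
  finally have 1: "fact ?m + fact (?m - 1) = ?z C + (\<Sum>A\<in>?\<C>. ?h (card A))"
    using s by (subst sum.remove[OF fin, of C]) auto
  have "(\<Sum>A\<in>?\<C>. ?h (card A)) = (\<Sum>l=1..?m. ((?m - 1) choose (l - 1)) * ?h l)"
    using sum_card_subsets_containing[OF less.prems(1) s, of ?h] by simp
  \<comment> \<open>All cycle lengths contribute equally. The total is \<open>fact ?m\<close>, which
    cancels in fact \<open>1\<close> and leaves the number of full cycles on
    \<open>C\<close>.\<close>
  also have "\<dots> = (\<Sum>l=1..?m. fact (?m - 1))"
    by (intro sum.cong refl) (use binomial_fact_split[of _ ?m] in \<open>simp flip: mult.assoc\<close>)
  also have "\<dots> = fact ?m"
    using m by (simp add: fact_reduce)
  finally show ?case using 1 by simp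
qed

section \<open>The recurrence solved by the truncated factorial\<close>

text \<open>If \<open>m \<le> j\<close>, no \<open>l\<close> is a multiple of \<open>j + 1\<close>
  and every term is 1. Otherwise the last \<open>j + 1\<close> values of \<open>l\<close> survive,
  exactly one of them is such a multiple, and its \<open>- (j + 1)\<close> cancels the ones.\<close>

lemma sum_cycle_weights_window:
  assumes "m \<ge> 1"
  shows "(\<Sum>l=1..m. (1 - (int j + 1) * of_bool ((j + 1) dvd l)) * of_bool (m - l \<le> j)) =
    int m * of_bool (m \<le> j)"
proof (cases "m \<le> j")
  case True
  have "\<not> (j + 1) dvd l" if "l \<in> {1..m}" for l
    using that True dvd_imp_le[of "j + 1" l] by auto
  then have "(\<Sum>l=1..m. (1 - (int j + 1) * of_bool ((j + 1) dvd l)) * of_bool (m - l \<le> j)) =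
    (\<Sum>l=1..m. 1)"
    using True by (intro sum.cong) auto
  then show ?thesis using True by simp
next
  case False
  \<comment> \<open>The surviving window is \<open>{a..m}\<close>, which has \<open>j + 1\<close>
    elements.\<close>
  define a where "a = m - j"
  have a: "a \<ge> 1" "m = a + j" using False by (auto simp: a_def)
  have "(\<Sum>l=1..m. (1 - (int j + 1) * of_bool ((j + 1) dvd l)) * of_bool (m - l \<le> j)) =
    (\<Sum>l=a..m. 1 - (int j + 1) * of_bool ((j + 1) dvd l))"
    by (rule sum.mono_neutral_cong_right) (use a in auto)
  also have "\<dots> = (int j + 1) - (int j + 1) * int (card {l \<in> {a..m}. (j + 1) dvd l})"
    using a by (simp add: sum_subtractf sum_distrib_left[symmetric] Int_def flip: of_bool_def)
  also have "card {l \<in> {a..m}. (j + 1) dvd l} = 1"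
  proof -
    \<comment> \<open>Dividing \<open>a - 1\<close> rather than \<open>a\<close> makes
      \<open>(j + 1) * (q + 1)\<close> the first multiple that is at least \<open>a\<close>, also
      when \<open>a\<close> itself is a multiple.\<close>
    define q where "q = (a - 1) div (j + 1)"
    define r where "r = (a - 1) mod (j + 1)"
    have aq: "a = (j + 1) * q + r + 1" and r: "r \<le> j"
      using a mult_div_mod_eq[of "j + 1" "a - 1"] by (auto simp: q_def r_def less_Suc_eq_le[symmetric])
    have "l = (j + 1) * (q + 1)" if l: "l \<in> {a..m}" "(j + 1) dvd l" for l
    proof -
      obtain t where t: "l = (j + 1) * t" using l(2) by blast
      \<comment> \<open>The window fits strictly between the multiples with factors \<open>q\<close>
        and \<open>q + 2\<close>.\<close>
      have "(j + 1) * q < (j + 1) * t" "(j + 1) * t < (j + 1) * (q + 2)"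
        using l(1) t aq r a by auto
      then have "t = q + 1" by (simp only: mult_less_cancel1) auto
      then show ?thesis using t by simp
    qed
    moreover have "(j + 1) * (q + 1) \<in> {a..m}" using a aq r by auto
    ultimately have "{l \<in> {a..m}. (j + 1) dvd l} = {(j + 1) * (q + 1)}" using dvd_triv_left by blast
    then show ?thesis by simp
  qed
  finally show ?thesis using False by simp
qed

text \<open>This will be the total cycle weight of all permutations of an \<open>m\<close>-element
  set; it is an integer to match the signed weights.\<close>

definition bounded_fact :: "nat \<Rightarrow> nat \<Rightarrow> int" where
  "bounded_fact j m = (if m \<le> j then fact m else 0)"

text \<open>The summand chooses the other \<open>l - 1\<close> points of the cycle, its cyclic
  order, its weight and the remainder. The factorials combine to \<open>fact (m - 1)\<close> for
  every \<open>l\<close>, and the window sum supplies the missing factor \<open>m\<close> or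
  0.\<close>

lemma sum_bounded_fact_recurrence:
  assumes "m \<ge> 1"
  shows "(\<Sum>l=1..m. int ((m - 1) choose (l - 1)) *
      (fact (l - 1) * (1 - (int j + 1) * of_bool ((j + 1) dvd l)) * bounded_fact j (m - l))) =
    bounded_fact j m"
proof -
  have "(\<Sum>l=1..m. int ((m - 1) choose (l - 1)) *
      (fact (l - 1) * (1 - (int j + 1) * of_bool ((j + 1) dvd l)) * bounded_fact j (m - l))) =
    (\<Sum>l=1..m. fact (m - 1) *
      ((1 - (int j + 1) * of_bool ((j + 1) dvd l)) * of_bool (m - l \<le> j)))"
  proof (rule sum.cong[OF refl])
    fix l assume "l \<in> {1..m}"
    then have "int ((m - 1) choose (l - 1)) * fact (l - 1) * fact (m - l) = fact (m - 1)"
      using arg_cong[OF binomial_fact_split[of l m], of int] by simp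
    then show "int ((m - 1) choose (l - 1)) *
        (fact (l - 1) * (1 - (int j + 1) * of_bool ((j + 1) dvd l)) * bounded_fact j (m - l)) =
      fact (m - 1) * ((1 - (int j + 1) * of_bool ((j + 1) dvd l)) * of_bool (m - l \<le> j))"
      by (auto simp: bounded_fact_def mult_ac)
  qed
  also have "\<dots> = fact (m - 1) * (int m * of_bool (m \<le> j))"
    unfolding sum_distrib_left[symmetric] sum_cycle_weights_window[OF assms] ..
  also have "\<dots> = bounded_fact j m"
    using assms by (simp add: bounded_fact_def fact_reduce)
  finally show ?thesis .
qed

section \<open>The product formula over level sets\<close>

text \<open>Induction on the size of \<open>S\<close>, removing the cycle through \<open>s\<close>,
  changes only the factor of the level set of \<open>s\<close>. A fixed \<open>T\<close> containing
  the image serves all smaller sets, since an empty level set contributes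
  \<open>bounded_fact j 0 = 1\<close>.\<close>

lemma sum_stabilizing_perms:
  fixes f :: "'a \<Rightarrow> 'b"
  assumes "finite S" "finite T" "f ` S \<subseteq> T"
  shows "(\<Sum>\<tau>\<in>stabilizing_perms S f.
      orbit_weight (\<lambda>l. 1 - (int j + 1) * of_bool ((j + 1) dvd l)) S \<tau>) =
    (\<Prod>x\<in>T. bounded_fact j (card {i \<in> S. f i = x}))"
  using assms
proof (induction "card S" arbitrary: S rule: less_induct)
  case less
  let ?c = "\<lambda>l. 1 - (int j + 1) * of_bool ((j + 1) dvd l)"
  show ?case
  proof (cases "S = {}")
    case True
    have "stabilizing_perms {} f = {id}" by (auto simp: stabilizing_perms_def)
    then show ?thesis using True by (simp add: orbit_weight_def bounded_fact_def)
  next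
    case False
    then obtain s where s: "s \<in> S" by blast
    let ?B = "{i \<in> S. f i = f s}"
    let ?P = "\<Prod>x\<in>T - {f s}. bounded_fact j (card {i \<in> S. f i = x})"
    have B: "finite ?B" "s \<in> ?B" using less.prems s by auto
    then have m: "card ?B \<ge> 1" by (auto simp: Suc_le_eq card_gt_0_iff)
    have fs: "f s \<in> T" using less.prems s by auto
    have rest: "(\<Sum>\<rho>\<in>stabilizing_perms (S - C) f. orbit_weight ?c (S - C) \<rho>) =
        bounded_fact j (card ?B - card C) * ?P" if C: "s \<in> C" "C \<subseteq> ?B" for C
    proof -
      have "card (S - C) < card S"
        using C s less.prems(1) by (intro psubset_card_mono) auto
      then have "(\<Sum>\<rho>\<in>stabilizing_perms (S - C) f. orbit_weight ?c (S - C) \<rho>) =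
          (\<Prod>x\<in>T. bounded_fact j (card {i \<in> S - C. f i = x}))"
        using less.prems by (intro less.hyps) auto
      also have "\<dots> = bounded_fact j (card {i \<in> S - C. f i = f s}) *
          (\<Prod>x\<in>T - {f s}. bounded_fact j (card {i \<in> S - C. f i = x}))"
        using less.prems(2) fs by (rule prod.remove)
      \<comment> \<open>\<open>C\<close> lies in the level set of \<open>s\<close>, so the other
        level sets lose nothing.\<close>
      also have "(\<Prod>x\<in>T - {f s}. bounded_fact j (card {i \<in> S - C. f i = x})) = ?P"
        using C by (intro prod.cong refl arg_cong[where f = "\<lambda>A. bounded_fact j (card A)"]) auto
      also have "{i \<in> S - C. f i = f s} = ?B - C" by auto
      also have "card (?B - C) = card ?B - card C"
        using C B(1) by (intro card_Diff_subset) (auto intro: finite_subset)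
      finally show ?thesis .
    qed
    have "(\<Sum>\<tau>\<in>stabilizing_perms S f. orbit_weight ?c S \<tau>) =
      (\<Sum>C | s \<in> C \<and> C \<subseteq> ?B. fact (card C - 1) * ?c (card C) *
         bounded_fact j (card ?B - card C) * ?P)"
      unfolding sum_stabilizing_perms_by_cycle[OF less.prems(1) s]
    proof (rule sum.cong[OF refl])
      fix C assume "C \<in> {C. s \<in> C \<and> C \<subseteq> ?B}"
      then have C: "s \<in> C" "C \<subseteq> ?B" by auto
      then have "finite C" "C \<noteq> {}" using B(1) finite_subset by blast+
      then show "int (card {\<sigma>. \<sigma> permutes C \<and> cyclic_on \<sigma> C}) * ?c (card C) *
          (\<Sum>\<rho>\<in>stabilizing_perms (S - C) f. orbit_weight ?c (S - C) \<rho>) =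
        fact (card C - 1) * ?c (card C) * bounded_fact j (card ?B - card C) * ?P"
        unfolding rest[OF C] by (simp add: card_full_cycles mult.assoc)
    qed
    also have "\<dots> = (\<Sum>C | s \<in> C \<and> C \<subseteq> ?B. fact (card C - 1) * ?c (card C) *
         bounded_fact j (card ?B - card C)) * ?P"
      by (rule sum_distrib_right[symmetric])
    \<comment> \<open>The summand depends on \<open>C\<close> only through its size, so the sum
      turns into one over cycle lengths.\<close>
    also have "\<dots> = bounded_fact j (card ?B) * ?P"
      unfolding sum_card_subsets_containing[OF B,
          of "\<lambda>l. fact (l - 1) * ?c l * bounded_fact j (card ?B - l)"]
        sum_bounded_fact_recurrence[OF m] ..
    also have "\<dots> = (\<Prod>x\<in>T. bounded_fact j (card {i \<in> S. f i = x}))"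
      using less.prems(2) fs by (rule prod.remove[symmetric])
    finally show ?thesis .
  qed
qed

section \<open>From tuples to multisets\<close>

lemma permute_list_fixed_iff_stabilizing:
  assumes "length xs = k"
  shows "\<tau> permutes {..<k} \<and> permute_list \<tau> xs = xs \<longleftrightarrow> \<tau> \<in> stabilizing_perms {..<k} (nth xs)"
  using assms by (auto simp: stabilizing_perms_def permute_list_def list_eq_iff_nth_eq)

text \<open>Take \<open>nth xs\<close> as the function on positions: its level sets are the places
  of each entry, and their sizes are the multiplicities.\<close>

lemma sum_cycle_weight_fixing:
  assumes "length xs = k"
  shows "(\<Sum>\<tau> | \<tau> permutes {..<k} \<and> permute_list \<tau> xs = xs. cycle_weight k j \<tau>) =
    (\<Prod>x\<in>set xs. bounded_fact j (count (mset xs) x))"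
proof -
  have "(\<Sum>\<tau> | \<tau> permutes {..<k} \<and> permute_list \<tau> xs = xs. cycle_weight k j \<tau>) =
    (\<Prod>x\<in>set xs. bounded_fact j (card {i \<in> {..<k}. xs ! i = x}))"
    unfolding permute_list_fixed_iff_stabilizing[OF assms] Collect_mem_eq
      cycle_weight_def perm_cycles_def
    by (rule sum_stabilizing_perms[unfolded orbit_weight_def]) (use assms in auto)
  also have "\<dots> = (\<Prod>x\<in>set xs. bounded_fact j (count (mset xs) x))"
    using assms by (simp add: count_mset count_list_eq_length_filter length_filter_conv_card eq_commute)
  finally show ?thesis .
qed

text \<open>Double counting of the pairs of a permutation and a tuple fixed by it, as in Burnside's
  lemma.\<close>

lemma sum_invariant_tuples_swap:
  assumes "finite X"
  shows "(\<Sum>\<tau> | \<tau> permutes {..<k}. w \<tau> * int (card (invariant_tuples X \<tau>))) =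
    (\<Sum>xs\<in>X. \<Sum>\<tau> | \<tau> permutes {..<k} \<and> permute_list \<tau> xs = xs. w \<tau>)"
proof -
  have "(\<Sum>\<tau> | \<tau> permutes {..<k}. w \<tau> * int (card (invariant_tuples X \<tau>))) =
    (\<Sum>\<tau> | \<tau> permutes {..<k}. \<Sum>xs | xs \<in> X \<and> permute_list \<tau> xs = xs. w \<tau>)"
    by (simp add: invariant_tuples_def mult.commute)
  also have "\<dots> = (\<Sum>xs\<in>X. \<Sum>\<tau> | \<tau> \<in> {\<tau>. \<tau> permutes {..<k}} \<and> permute_list \<tau> xs = xs. w \<tau>)"
    by (rule sum.swap_restrict) (use assms finite_permutations in auto)
  finally show ?thesis by simp
qed

text \<open>Lists with equal multisets differ by a permutation of positions, so by symmetry one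
  ordering in \<open>X\<close> brings in all others.\<close>

lemma symmetric_tuples_fibre:
  assumes "X \<subseteq> nlists k D" "symmetric_tuples k X" "M \<in> multisets_of X"
  shows "{xs \<in> X. mset xs = M} = permutations_of_multiset M"
proof -
  obtain ys where ys: "ys \<in> X" "mset ys = M"
    using assms(3) by (auto simp: multisets_of_def)
  have "xs \<in> X" if xs: "mset xs = M" for xs
  proof -
    obtain p where "p permutes {..<length ys}" "permute_list p ys = xs"
      using mset_eq_permutation[of xs ys] xs ys(2) by auto
    then show ?thesis
      using assms(1,2) ys(1) by (auto simp: symmetric_tuples_def dest: nlistsE_length)
  qed
  then show ?thesis by (auto simp: permutations_of_multiset_def)
qed

text \<open>The contribution of a tuple depends only on its multiset \<open>M\<close>. Multiplied by
  the number of orderings of \<open>M\<close>, it gives \<open>fact k\<close>, or 0 if some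
  multiplicity exceeds \<open>j\<close>. Keeping \<open>fact k\<close> on the right avoids division
  in the integers.\<close>

lemma card_bounded_multisets_of:
  assumes "X \<subseteq> nlists k D" "finite X" "symmetric_tuples k X"
  shows "(\<Sum>\<tau> | \<tau> permutes {..<k}. cycle_weight k j \<tau> * int (card (invariant_tuples X \<tau>))) =
    fact k * int (card (bounded_multisets_of j X))"
proof -
  let ?g = "\<lambda>M. \<Prod>x\<in>set_mset M. bounded_fact j (count M x)"
  have len: "length xs = k" if "xs \<in> X" for xs
    using that assms(1) nlistsE_length by blast
  have fin: "finite (multisets_of X)"
    using assms(2) by (simp add: multisets_of_def)
  have "(\<Sum>\<tau> | \<tau> permutes {..<k}. cycle_weight k j \<tau> * int (card (invariant_tuples X \<tau>))) =
    (\<Sum>xs\<in>X. ?g (mset xs))"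
    unfolding sum_invariant_tuples_swap[OF assms(2)]
    by (rule sum.cong) (simp_all add: sum_cycle_weight_fixing len)
  also have "\<dots> = (\<Sum>M\<in>multisets_of X. \<Sum>xs | xs \<in> X \<and> mset xs = M. ?g (mset xs))"
    by (rule sum.group[symmetric]) (use assms(2) fin in \<open>auto simp: multisets_of_def\<close>)
  also have "\<dots> = (\<Sum>M\<in>multisets_of X. if \<forall>x\<in>#M. count M x \<le> j then fact k else 0)"
  proof (rule sum.cong[OF refl])
    fix M assume M: "M \<in> multisets_of X"
    then have size: "size M = k" using len by (auto simp: multisets_of_def)
    have "(\<Sum>xs | xs \<in> X \<and> mset xs = M. ?g (mset xs)) = int (card (permutations_of_multiset M)) * ?g M"
    proof -
      have "(\<Sum>xs | xs \<in> X \<and> mset xs = M. ?g (mset xs)) = (\<Sum>xs | xs \<in> X \<and> mset xs = M. ?g M)"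
        by (rule sum.cong) auto
      then show ?thesis by (simp add: symmetric_tuples_fibre[OF assms(1,3) M])
    qed
    also have "\<dots> = (if \<forall>x\<in>#M. count M x \<le> j then fact k else 0)"
    proof (cases "\<forall>x\<in>#M. count M x \<le> j")
      case True
      then have "?g M = int (\<Prod>x\<in>set_mset M. fact (count M x))"
        by (simp add: bounded_fact_def)
      \<comment> \<open>Multinomial count without division: the number of orderings times the
        product of the factorials of the multiplicities is \<open>fact (size M)\<close>.\<close>
      then show ?thesis
        using True arg_cong[OF card_permutations_of_multiset_aux[of M], of int] size by simp
    next
      case False
      then have "?g M = 0" by (auto simp: bounded_fact_def intro!: prod_zero)
      then show ?thesis using False by auto
    qed
    finally show "(\<Sum>xs | xs \<in> X \<and> mset xs = M. ?g (mset xs)) =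
      (if \<forall>x\<in>#M. count M x \<le> j then fact k else 0)" .
  qed
  also have "\<dots> = (\<Sum>M\<in>bounded_multisets_of j X. fact k)"
    unfolding bounded_multisets_of_def by (rule sum.inter_filter[OF fin, symmetric])
  finally show ?thesis by (simp add: mult.commute)
qed

section \<open>Trivial weights for large \<open>j\<close>, and the conclusion\<close>

text \<open>A cycle has between 1 and \<open>k\<close> elements, too few for a positive multiple of
  \<open>j + 1\<close>.\<close>

lemma cycle_weight_eq_1:
  assumes "\<tau> permutes {..<k}" "k \<le> j"
  shows "cycle_weight k j \<tau> = 1"
  unfolding cycle_weight_def
proof (rule prod.neutral, rule ballI)
  fix C assume "C \<in> perm_cycles k \<tau>"
  then obtain i where i: "i < k" "C = orbit \<tau> i" by (auto simp: perm_cycles_def)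
  then have C: "C \<subseteq> {..<k}" "C \<noteq> {}"
    using permutes_orbit_subset[OF assms(1)] orbit_nonempty[of \<tau> i] by auto
  then have "0 < card C" "card C \<le> k"
    using finite_subset[OF C(1)] card_mono[OF _ C(1)] by (auto simp: card_gt_0_iff)
  \<comment> \<open>Positivity of \<open>card C\<close> matters here, as \<open>j + 1\<close>
    divides 0.\<close>
  then have "\<not> (j + 1) dvd card C"
    using assms(2) dvd_imp_le[of "j + 1" "card C"] by linarith
  then show "1 - (int j + 1) * of_bool ((j + 1) dvd card C) = 1" by simp
qed

theorem theorem1p6:
  fixes D :: "'a set" and k j :: nat and X :: "'a list set"
  assumes "k \<ge> 1" and "X \<subseteq> nlists k D" and "finite X" and "symmetric_tuples k X"
    and "j \<ge> 1"
  shows "real (card (bounded_multisets_of j X)) =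
           1 / fact k * (\<Sum>\<tau> | \<tau> permutes {..<k}.
             real_of_int (cycle_weight k j \<tau>) * real (card (invariant_tuples X \<tau>)))
         \<and> (j \<ge> k \<longrightarrow> real (card (multisets_of X)) =
           1 / fact k * (\<Sum>\<tau> | \<tau> permutes {..<k}. real (card (invariant_tuples X \<tau>))))"
proof -
  have 1: "real (card (bounded_multisets_of j X)) =
      1 / fact k * (\<Sum>\<tau> | \<tau> permutes {..<k}.
        real_of_int (cycle_weight k j \<tau>) * real (card (invariant_tuples X \<tau>)))"
    using arg_cong[OF card_bounded_multisets_of[OF assms(2-4), of j], of real_of_int] by simp
  \<comment> \<open>No multiplicity exceeds the length \<open>k\<close> of the tuple, so the bound
    by \<open>j\<close> is automatic.\<close>
  have 2: "bounded_multisets_of j X = multisets_of X" if "j \<ge> k"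
  proof -
    have "count (mset xs) x \<le> j" if "xs \<in> X" for xs x
    proof -
      have "length xs = k" using that assms(2) nlistsE_length by blast
      then show ?thesis using count_le_length[of xs x] \<open>j \<ge> k\<close> by (simp add: count_mset)
    qed
    then show ?thesis by (auto simp: bounded_multisets_of_def multisets_of_def)
  qed
  show ?thesis
  proof (intro conjI impI)
    assume "j \<ge> k"
    then show "real (card (multisets_of X)) =
        1 / fact k * (\<Sum>\<tau> | \<tau> permutes {..<k}. real (card (invariant_tuples X \<tau>)))"
      using 1 2 by (simp add: cycle_weight_eq_1)
  qed (fact 1)
qed

end
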